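(* Let $p$ be a prime with $p\equiv 1\pmod{12}$. If $n=p+1$, then $D_n(1,x)$ is a complete permutation polynomial of $\mathbb{F}_p$.
   Context: The $n$th reversed Dickson polynomial of the first kind (with parameter $1$) is the integer-coefficient polynomial $D_n(1,x)$ defined by $D_0(1,x)=2$, $D_1(1,x)=1$, $D_n(1,x)=D_{n-1}(1,x)-x\,D_{n-2}(1,x)$ for $n\ge 2$. Coefficients are reduced modulo $p$ to regard it as a polynomial over $\mathbb{F}_p$. A polynomial $f$ is a permutation polynomial of $\mathbb{F}_p$ if the map it induces $\mathbb{F}_p\to\mathbb{F}_p$ is a bijection, and a complete permutation polynomial if both $f(x)$ and $f(x)+x$ are permutation polynomials of $\mathbb{F}_p$. *)

theory Defs
  imports "Berlekamp_Zassenhaus.Finite_Field"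
begin

text \<open>Reversed Dickson polynomials \<open>D\<^sub>n(1, x)\<close> of the first kind, as polynomials over the integers.\<close>

fun rev_dickson :: "nat \<Rightarrow> int poly" where
  "rev_dickson 0 = [:2:]"
| "rev_dickson (Suc 0) = [:1:]"
| "rev_dickson (Suc (Suc n)) = rev_dickson (Suc n) - [:0, 1:] * rev_dickson n"

definition permutation_poly :: "'a::{finite,field} poly \<Rightarrow> bool" where
  "permutation_poly f \<longleftrightarrow> bij (\<lambda>x. poly f x)"

definition complete_permutation_poly :: "'a::{finite,field} poly \<Rightarrow> bool" where
  "complete_permutation_poly f \<longleftrightarrow> permutation_poly f \<and> permutation_poly (f + [:0, 1:])"

end

theory Submission
  imports Defs
begin

text \<open>
  Write \<open>q\<close> for the order of the field and \<open>s = 1 - 4 x\<close>. If \<open>s = u\<^sup>2\<close>, then \<open>(1 + u) / 2\<close> and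
  \<open>(1 - u) / 2\<close> have sum \<open>1\<close> and product \<open>x\<close>, so the Dickson recursion gives
  \<open>2\<^sup>n D\<^sub>n(1, x) = (1 + u)\<^sup>n + (1 - u)\<^sup>n\<close>. For \<open>n = q + 1\<close> the Frobenius map \<open>(1 \<plusminus> u)\<^sup>q = 1 \<plusminus> u\<^sup>q\<close>
  collapses the right-hand side to \<open>2 + 2 u\<^bsup>q+1\<^esup>\<close>. Hence, with \<open>q = 2 k + 1\<close>,
  \<open>2 D\<^bsub>q+1\<^esub>(1, x) = 1 + s\<^bsup>k+1\<^esup>\<close>.
  Only about half of the values of \<open>s\<close> have a square root in the field. Taking for \<open>u\<close> the indeterminate of
  the polynomial ring, and then cancelling the substitution \<open>S \<mapsto> u\<^sup>2\<close>, proves the formula for all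
  \<open>s\<close> without passing to a quadratic extension.

  By Euler's criterion \<open>s\<^sup>k\<close> is the quadratic character, so in the variable \<open>s\<close> the maps
  \<open>D\<^bsub>q+1\<^esub>\<close> and \<open>D\<^bsub>q+1\<^esub> + x\<close> are, up to an affine change of the value, multiplication of \<open>s\<close> by a
  constant that depends only on the character of \<open>s\<close>: \<open>1\<close> or \<open>-1\<close> for the former, \<open>1\<close> or \<open>-3\<close> for
  the latter. Such a map is a bijection as soon as both constants are nonzero squares, because it then preserves
  the character, and so the character of \<open>s\<close>, and with it \<open>s\<close>, can be read off from the value. The
  congruence \<open>q \<equiv> 1 (mod 12)\<close> is used exactly here: \<open>-1\<close> is a square because \<open>q \<equiv> 1 (mod 4)\<close>, and
  \<open>-3\<close> is a square because \<open>q \<equiv> 1 (mod 3)\<close>.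
\<close>

text \<open>
  This is the functional equation \<open>D\<^sub>n(1, y (1 - y)) = y\<^sup>n + (1 - y)\<^sup>n\<close> at \<open>y = (1 + u) / 2\<close>, cleared of
  denominators so that it holds in every commutative ring.
\<close>
lemma rev_dickson_functional_equation:
  fixes x u :: "'a::comm_ring_1"
  assumes u: "4 * x = 1 - u ^ 2"
  shows "2 ^ n * poly (of_int_poly (rev_dickson n)) x = (1 + u) ^ n + (1 - u) ^ n"
proof (induction n rule: rev_dickson.induct)
  case (3 n)
  let ?d = "\<lambda>n. poly (of_int_poly (rev_dickson n)) x"
  have "2 ^ Suc (Suc n) * ?d (Suc (Suc n)) = 2 * (2 ^ Suc n * ?d (Suc n)) - 4 * x * (2 ^ n * ?d n)"
    by (simp add: hom_distribs algebra_simps)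
  also have "\<dots> = (1 + u) ^ Suc (Suc n) + (1 - u) ^ Suc (Suc n)"
    unfolding 3 u by (simp add: algebra_simps power2_eq_square)
  finally show ?case .
qed simp_all

lemma inj_pcompose_square:
  fixes f g :: "'a::idom poly"
  assumes "pcompose f [:0, 0, 1:] = pcompose g [:0, 0, 1:]"
  shows "f = g"
  using pcompose_eq_0[of "f - g" "[:0, 0, 1:]"] assms by (simp add: pcompose_diff)

text \<open>
  The Frobenius map is applied in the polynomial ring, where \<open>1 - u\<^sup>2\<close> is a multiple of \<open>4\<close> and \<open>u\<close>
  is the indeterminate; the resulting identity involves only powers of \<open>u\<^sup>2\<close>.
\<close>
lemma rev_dickson_char_power_plus_1:
  fixes x :: "'a::field_prime_char"
  assumes two: "(2::'a) \<noteq> 0" and q: "CHAR('a) ^ r = 2 * k + 1"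
  shows "2 * poly (of_int_poly (rev_dickson (CHAR('a) ^ r + 1))) x = 1 + (1 - 4 * x) ^ (k + 1)"
proof -
  define q where "q = CHAR('a) ^ r"
  define f :: "'a poly" where "f = of_int_poly (rev_dickson (q + 1))"
  define X :: "'a poly" where "X = [:0, 1:]"
  define c :: 'a where "c = inverse 4"
  have four: "(4::'a) \<noteq> 0" using two by (metis mult_2 mult_eq_0_iff numeral_Bit0)
  define g where "g = [:c, - c:]"
  have sq: "[:0, 0, 1:] = X ^ 2"
    by (simp add: X_def power2_eq_square)
  have lift: "map_poly (\<lambda>a. [:a:]) f = (of_int_poly (rev_dickson (q + 1)) :: 'a poly poly)"
    unfolding f_def by (rule poly_eqI) (simp add: coeff_map_poly of_int_poly)
  have frob: "(a + b) ^ q = a ^ q + b ^ q" for a b :: "'a poly"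
    by (rule freshmans_dream'[where n = r]) (simp_all add: q_def prime_CHAR_semidom)
  have odd: "odd q"
    using q unfolding q_def by simp
  have minus: "(1 - X) ^ q = 1 - X ^ q"
    using frob[of 1 "- X"] odd by simp
  have sq_pow: "(X ^ 2) ^ (k + 1) = X * X ^ q"
    using q unfolding q_def by (simp flip: power_mult power_Suc)
  have "4 * pcompose g (X ^ 2) = 1 - X ^ 2"
    using four by (simp add: g_def c_def X_def power2_eq_square numeral_poly pcompose_pCons one_pCons)
  from rev_dickson_functional_equation[OF this, of "q + 1"]
  have "2 ^ (q + 1) * pcompose f (pcompose g (X ^ 2)) = (1 + X) ^ (q + 1) + (1 - X) ^ (q + 1)"
    unfolding pcompose_altdef[of f] lift .
  also have "\<dots> = 2 + 2 * (X ^ 2) ^ (k + 1)"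
    unfolding sq_pow unfolding power_add frob minus by (simp add: algebra_simps)
  also have "(2::'a poly) ^ (q + 1) = 4"
    using frob[of 1 1] by simp
  finally have "2 * (2 * pcompose f (pcompose g (X ^ 2))) = 2 * (1 + (X ^ 2) ^ (k + 1))"
    by (simp add: algebra_simps)
  hence "2 * pcompose f (pcompose g (X ^ 2)) = 1 + (X ^ 2) ^ (k + 1)"
    unfolding mult_cancel_left using two by (simp add: numeral_poly)
  also have "\<dots> = pcompose (1 + X ^ (k + 1)) [:0, 0, 1:]"
    by (simp add: pcompose_add pcompose_1 pcompose_hom.hom_power X_def sq)
  finally have "pcompose (2 * pcompose f g) [:0, 0, 1:] = pcompose (1 + X ^ (k + 1)) [:0, 0, 1:]"
    unfolding mult_2 pcompose_add pcompose_assoc[symmetric] sq .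
  hence "2 * pcompose f g = 1 + X ^ (k + 1)"
    by (rule inj_pcompose_square)
  hence "poly (2 * pcompose f g) (1 - 4 * x) = poly (1 + X ^ (k + 1)) (1 - 4 * x)"
    by (rule arg_cong)
  moreover have "poly g (1 - 4 * x) = x"
    using four by (simp add: g_def c_def field_simps)
  ultimately show ?thesis
    by (simp add: poly_pcompose X_def f_def q_def)
qed

lemma half_power_eq_1_or_minus_1:
  fixes s :: "'a::finite_field"
  assumes "CARD('a) = 2 * k + 1" "s \<noteq> 0"
  shows "s ^ k = 1 \<or> s ^ k = - 1"
proof -
  have "s * (s ^ k) ^ 2 = s * 1"
    using finite_field_power_card_eq_same[of s] assms(1) by (simp add: power_mult[symmetric] mult.commute)
  hence "(s ^ k) ^ 2 = 1" using assms(2) by simp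
  thus ?thesis by (simp add: power2_eq_1_iff)
qed

text \<open>
  Multiplication by a constant whose \<open>k\<close>-th power is \<open>1\<close> does not change the \<open>k\<close>-th power. The value
  of the map therefore determines which constant was used, and then \<open>s\<close> itself. In a field of order
  \<open>2 k + 1\<close> the hypotheses say that both constants are nonzero squares.
\<close>
lemma inj_mult_by_quadratic_character:
  fixes a b :: "'a::field"
  assumes "k > 0" "a ^ k = 1" "b ^ k = 1"
  shows "inj (\<lambda>s. (if s ^ k = 1 then a else b) * s)"
proof (rule injI)
  fix s t :: 'a
  let ?c = "\<lambda>s. if s ^ k = 1 then a else b"
  assume eq: "?c s * s = ?c t * t"
  have val: "(?c s * s) ^ k = s ^ k" for s
    using assms by (simp add: power_mult_distrib)
  have "s ^ k = t ^ k"
    using val[of s] val[of t] eq by metis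
  moreover have "a \<noteq> 0" "b \<noteq> 0"
    using assms by (auto simp: zero_power)
  ultimately show "s = t"
    using eq by (auto split: if_splits)
qed

text \<open>
  A primitive cube root of unity \<open>w\<close> gives the square root \<open>2 w + 1\<close> of \<open>-3\<close>. It is found as a power
  \<open>a\<^sup>m\<close>, where \<open>q = 3 m + 1\<close>: not all units are roots of \<open>X\<^sup>m - 1\<close>, since there are \<open>3 m\<close> of them.
\<close>
lemma minus_3_eq_square:
  assumes q: "CARD('a::finite_field) = 3 * m + 1"
  obtains z :: "'a::finite_field" where "z \<noteq> 0" "z ^ 2 = - 3"
proof -
  have m: "m > 0"
    using q card_mono[of UNIV "{0, 1 :: 'a}"] by simp
  have "\<exists>a::'a. a \<noteq> 0 \<and> a ^ m \<noteq> 1"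
  proof (rule ccontr)
    assume "\<not> ?thesis"
    hence sub: "- {0} \<subseteq> {x::'a. poly (monom 1 m - 1) x = 0}"
      by (auto simp: poly_monom)
    have "coeff (monom 1 m - 1 :: 'a poly) m = 1"
      using m by simp
    hence nz: "monom 1 m - 1 \<noteq> (0 :: 'a poly)"
      by (metis coeff_0 zero_neq_one)
    have "3 * m = card (- {0 :: 'a})"
      using q by (simp add: Compl_eq_Diff_UNIV)
    also have "\<dots> \<le> card {x::'a. poly (monom 1 m - 1) x = 0}"
      by (rule card_mono[OF _ sub]) simp
    also have "\<dots> \<le> degree (monom 1 m - 1 :: 'a poly)"
      by (rule card_poly_roots_bound[OF nz])
    also have "\<dots> \<le> m"
      by (intro degree_diff_le) (auto simp: degree_monom_le)
    finally show False using m by simp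
  qed
  then obtain a :: 'a where a: "a \<noteq> 0" "a ^ m \<noteq> 1" by blast
  define w where "w = a ^ m"
  have "a * w ^ 3 = a * 1"
    using finite_field_power_card_eq_same[of a] q
    by (simp add: w_def power_mult[symmetric] mult.commute)
  hence "w ^ 3 = 1" using a(1) by simp
  hence "(w - 1) * (w ^ 2 + w + 1) = 0"
    by (simp add: algebra_simps power2_eq_square power3_eq_cube)
  hence w: "w ^ 2 + w + 1 = 0" using a(2) by (simp add: w_def)
  have sq: "(2 * w + 1) ^ 2 = - 3"
  proof -
    have "(2 * w + 1) ^ 2 = 4 * (w ^ 2 + w + 1) - 3"
      by (simp add: algebra_simps power2_eq_square)
    thus ?thesis using w by simp
  qed
  moreover have "2 * w + 1 \<noteq> 0"
  proof
    assume 0: "2 * w + 1 = 0"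
    \<comment> \<open>Then \<open>3 = 0\<close>, and in characteristic \<open>3\<close> the only cube root of unity is \<open>1\<close>.\<close>
    have "(w - 1) ^ 2 = (w ^ 2 + w + 1) + (- 3) * w"
      by (simp add: algebra_simps power2_eq_square)
    also have "\<dots> = 0"
      using w sq 0 by (metis add_0 mult_zero_left zero_power2)
    finally show False using a(2) by (simp add: w_def)
  qed
  ultimately show thesis using that by blast
qed

text \<open>
  That \<open>q\<close> is a power of the characteristic is what makes \<open>f \<mapsto> f\<^sup>q\<close> additive on polynomials; the
  prime field is the case \<open>r = 1\<close>.
\<close>
theorem rev_dickson_complete_permutation_poly:
  assumes q: "CARD('a::finite_field) = CHAR('a::finite_field) ^ r" and mod: "[CARD('a::finite_field) = 1] (mod 12)"
  shows "complete_permutation_poly (of_int_poly (rev_dickson (CARD('a) + 1)) :: 'a::finite_field poly)"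
proof -
  have "CARD('a) > 1"
    using card_mono[of UNIV "{0, 1 :: 'a}"] by simp
  moreover from mod this obtain l where l: "CARD('a) = 12 * l + 1"
    by (metis cong_to_1_nat dvdE le_add_diff_inverse2 less_imp_le)
  ultimately have "l > 0" by simp
  define k where "k = 6 * l"
  have k: "CARD('a) = 2 * k + 1" "k > 0" "even k"
    using l \<open>l > 0\<close> by (auto simp: k_def)
  have two: "(2::'a) \<noteq> 0"
    proof
    assume "(2::'a) = 0"
    moreover have "(of_nat (2 * k + 1) :: 'a) = 0"
      using CHAR_dvd_CARD[where 'a = 'a] k(1) of_nat_eq_0_iff_char_dvd by metis
    ultimately show False by simp
  qed
  hence four: "(4::'a) \<noteq> 0"
    by (metis mult_2 mult_eq_0_iff numeral_Bit0)
  define f :: "'a poly" where "f = of_int_poly (rev_dickson (CARD('a) + 1))"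
  \<comment> \<open>\<open>h (- 1) s = s\<^bsup>k+1\<^esup>\<close>, and adding \<open>4 x = 1 - s\<close> to \<open>4 D = 2 + 2 h (- 1) s\<close> turns the factors
    \<open>2\<close> and \<open>-2\<close> of \<open>s\<close> into \<open>1\<close> and \<open>-3\<close>.\<close>
  define h where "h b s = (if s ^ k = 1 then 1 else b) * s" for b s :: 'a
  have f: "2 * poly f x = 1 + h (- 1) (1 - 4 * x)" for x
  proof -
    have "2 * poly f x = 1 + (1 - 4 * x) ^ (k + 1)"
      using rev_dickson_char_power_plus_1[OF two, of r k x] q k by (simp add: f_def)
    also have "s ^ (k + 1) = h (- 1) s" for s
      using half_power_eq_1_or_minus_1[OF k(1), of s] by (cases "s = 0") (auto simp: h_def)
    finally show ?thesis .
  qed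
  have fx: "4 * poly (f + [:0, 1:]) x = 3 + h (- 3) (1 - 4 * x)" for x
  proof -
    have "4 * poly (f + [:0, 1:]) x = 2 * (2 * poly f x) + 4 * x" by simp
    also have "\<dots> = 3 + h (- 3) (1 - 4 * x)"
      unfolding f by (auto simp: h_def algebra_simps)
    finally show ?thesis .
  qed
  have cancel: "x = y" if "1 - 4 * x = 1 - 4 * y" for x y :: 'a
    using that four by simp
  have inj_h1: "inj (h (- 1))"
    unfolding h_def by (rule inj_mult_by_quadratic_character) (use k in auto)
  have inj_f: "inj (poly f)"
  proof (rule injI, rule cancel)
    fix x y
    assume "poly f x = poly f y"
    hence "h (- 1) (1 - 4 * x) = h (- 1) (1 - 4 * y)"
      using f[of x] f[of y] by (metis add_left_cancel)
    thus "1 - 4 * x = 1 - 4 * y"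
      using inj_h1 by (rule injD[rotated])
  qed
  have inj_h3: "inj (h (- 3))"
  proof -
    obtain z :: 'a where z: "z \<noteq> 0" "z ^ 2 = - 3"
      using minus_3_eq_square[of "4 * l"] l by auto
    have "z * (- 3) ^ k = z * 1"
      using finite_field_power_card_eq_same[of z] k(1) by (simp add: z(2)[symmetric] power_mult)
    thus ?thesis
      unfolding h_def using z by (intro inj_mult_by_quadratic_character) (use k in auto)
  qed
  have inj_fx: "inj (poly (f + [:0, 1:]))"
  proof (rule injI, rule cancel)
    fix x y
    assume "poly (f + [:0, 1:]) x = poly (f + [:0, 1:]) y"
    hence "h (- 3) (1 - 4 * x) = h (- 3) (1 - 4 * y)"
      using fx[of x] fx[of y] by (metis add_left_cancel)
    thus "1 - 4 * x = 1 - 4 * y"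
      using inj_h3 by (rule injD[rotated])
  qed
  show ?thesis
    using inj_f inj_fx finite_UNIV_inj_surj[OF finite[of "UNIV :: 'a set"]]
    unfolding complete_permutation_poly_def permutation_poly_def f_def bij_def by blast
qed

theorem proposition3p34:
  fixes p n :: nat
  assumes "prime p" and "CARD('p::prime_card) = p"
    and "[p = 1] (mod 12)"
    and "n = p + 1"
  shows "complete_permutation_poly (of_int_poly (rev_dickson n) :: 'p mod_ring poly)"
proof -
  have "CARD('p mod_ring) = CHAR('p mod_ring) ^ 1"
    by simp
  moreover have "[CARD('p mod_ring) = 1] (mod 12)"
    using assms by simp
  ultimately have
    "complete_permutation_poly (of_int_poly (rev_dickson (CARD('p mod_ring) + 1)) :: 'p mod_ring poly)"
    by (rule rev_dickson_complete_permutation_poly)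
  thus ?thesis
    using assms by simp
qed

end
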